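(* A parallelogram $D$ in the $xy$ plane is bielliptic if and only if the square of the length of one of the diagonals of $D$ equals twice the square of the length of one of the sides of $D$.
   Context: Parallelograms are nondegenerate. Ellipses include circles. An ellipse is inscribed in a convex quadrilateral $D$ if it lies in $D$ and is tangent to each of the four sides of $D$; it is circumscribed about $D$ if it passes through all four vertices of $D$. If $a\ge b>0$ are the lengths of the semi-major and semi-minor axes of an ellipse, its eccentricity is $\sqrt{1-b^2/a^2}$ (so a circle has eccentricity $0$). For a convex quadrilateral $D$ there is a unique ellipse $E_I$ of minimal eccentricity among the ellipses inscribed in $D$, and a unique ellipse $E_O$ of minimal eccentricity among the ellipses circumscribed about $D$. The quadrilateral $D$ is called bielliptic if $E_I$ and $E_O$ have the same eccentricity. *)

theory Defs
  imports "HOL-Analysis.Analysis"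
begin

definition ellipse_path ::
    "real^2 \<Rightarrow> real^2 \<Rightarrow> real^2 \<Rightarrow> real \<Rightarrow> real \<Rightarrow> real \<Rightarrow> real^2" where
  "ellipse_path c u v a b t = c + (a * cos t) *\<^sub>R u + (b * sin t) *\<^sub>R v"

text \<open>An ellipse is the curve itself, not the region it bounds. The vectors \<open>u\<close> and \<open>v\<close> are unit
  vectors along its axes, \<open>a\<close> and \<open>b\<close> the lengths of its semi-major and semi-minor axes.\<close>

definition ellipse_with ::
    "(real^2) set \<Rightarrow> real^2 \<Rightarrow> real^2 \<Rightarrow> real^2 \<Rightarrow> real \<Rightarrow> real \<Rightarrow> bool" where
  "ellipse_with E c u v a b \<longleftrightarrow>
     norm u = 1 \<and> norm v = 1 \<and> orthogonal u v \<and> 0 < b \<and> b \<le> a \<and>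
     E = range (ellipse_path c u v a b)"

definition ellipse :: "(real^2) set \<Rightarrow> bool" where
  "ellipse E \<longleftrightarrow> (\<exists>c u v a b. ellipse_with E c u v a b)"

text \<open>The semi-axes are determined by the curve (although \<open>u\<close> and \<open>v\<close> are not), so the
  description below is proper for every ellipse.\<close>

definition eccentricity :: "(real^2) set \<Rightarrow> real" where
  "eccentricity E = (THE e. \<exists>c u v a b. ellipse_with E c u v a b \<and> e = sqrt (1 - b\<^sup>2 / a\<^sup>2))"

text \<open>The point of tangency has to lie on the segment, not merely on the line through it.\<close>

definition tangent_to_segment :: "(real^2) set \<Rightarrow> real^2 \<Rightarrow> real^2 \<Rightarrow> bool" where
  "tangent_to_segment E P Q \<longleftrightarrow>
     (\<exists>c u v a b t. ellipse_with E c u v a b \<and>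
        ellipse_path c u v a b t \<in> closed_segment P Q \<and>
        affine hull {P, Q} =
          range (\<lambda>s. ellipse_path c u v a b t +
                     s *\<^sub>R vector_derivative (ellipse_path c u v a b) (at t)))"

text \<open>Convex quadrilaterals are given by their vertices in cyclic order.\<close>

definition inscribed :: "real^2 \<Rightarrow> real^2 \<Rightarrow> real^2 \<Rightarrow> real^2 \<Rightarrow> (real^2) set \<Rightarrow> bool" where
  "inscribed A B C D E \<longleftrightarrow>
     ellipse E \<and> E \<subseteq> convex hull {A, B, C, D} \<and>
     tangent_to_segment E A B \<and> tangent_to_segment E B C \<and>
     tangent_to_segment E C D \<and> tangent_to_segment E D A"

definition circumscribed :: "real^2 \<Rightarrow> real^2 \<Rightarrow> real^2 \<Rightarrow> real^2 \<Rightarrow> (real^2) set \<Rightarrow> bool" where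
  "circumscribed A B C D E \<longleftrightarrow> ellipse E \<and> {A, B, C, D} \<subseteq> E"

definition bielliptic :: "real^2 \<Rightarrow> real^2 \<Rightarrow> real^2 \<Rightarrow> real^2 \<Rightarrow> bool" where
  "bielliptic A B C D \<longleftrightarrow>
     (\<exists>E\<^sub>I E\<^sub>O. is_arg_min eccentricity (inscribed A B C D) E\<^sub>I \<and>
              is_arg_min eccentricity (circumscribed A B C D) E\<^sub>O \<and>
              eccentricity E\<^sub>I = eccentricity E\<^sub>O)"

definition parallelogram :: "real^2 \<Rightarrow> real^2 \<Rightarrow> real^2 \<Rightarrow> real^2 \<Rightarrow> bool" where
  "parallelogram A B C D \<longleftrightarrow> B - A = C - D \<and> \<not> collinear {A, B, C}"

end

theory Submission
  imports Defs
begin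

text \<open>
  Let \<open>M\<close> be the centre and \<open>2 p\<close>, \<open>2 q\<close> the sides of the parallelogram, and put \<open>P = p \<bullet> p\<close>,
  \<open>Q = q \<bullet> q\<close>, \<open>G = p \<bullet> q\<close>, \<open>\<Delta>\<^sup>2 = P Q - G\<^sup>2\<close>. The eccentricity is a decreasing function of
  \<open>(a b / (a\<^sup>2 + b\<^sup>2))\<^sup>2\<close>, that is, of the determinant over the squared trace of the shape matrix
  \<open>a\<^sup>2 u u\<^sup>T + b\<^sup>2 v v\<^sup>T\<close>. For a circumscribed ellipse this matrix is
  \<open>p p\<^sup>T / \<alpha> + q q\<^sup>T / \<beta>\<close> with \<open>\<alpha> + \<beta> = 1\<close>, and by AM-GM the maximum of the quotient is
  \<open>\<Delta>\<^sup>2 / (4 P Q)\<close>. For an inscribed ellipse it is \<open>p p\<^sup>T + q q\<^sup>T + \<rho> (p q\<^sup>T + q p\<^sup>T)\<close> with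
  \<open>\<bar>\<rho>\<bar> < 1\<close>, and the maximum, at \<open>\<rho> = - 2 G / (P + Q)\<close>, is
  \<open>\<Delta>\<^sup>2 / ((P + Q)\<^sup>2 - 4 G\<^sup>2)\<close>. The two maxima agree iff \<open>P - Q = \<plusminus> 2 G\<close>.
\<close>

section \<open>Sinusoids and planar inner products\<close>

text \<open>The maximum of a sinusoid is its amplitude: its value at \<open>Arg z\<close> is
  \<open>cmod z\<close>, which bounds \<open>K\<close> from below, and Lagrange's identity at
  \<open>s\<close> bounds \<open>K^2\<close> from above.\<close>

lemma trig_polynomial_max:
  fixes A B K :: real
  assumes "\<And>t. A * cos t + B * sin t \<le> K" and "A * cos s + B * sin s = K"
  shows "0 \<le> K" "K\<^sup>2 = A\<^sup>2 + B\<^sup>2"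
proof -
  define z where "z = Complex A B"
  have A: "A = cmod z * cos (Arg z)" and B: "B = cmod z * sin (Arg z)"
    by (metis z_def complex.sel rcis_cmod_Arg Re_rcis, metis z_def complex.sel rcis_cmod_Arg Im_rcis)
  have R: "(cmod z)\<^sup>2 = A\<^sup>2 + B\<^sup>2"
    by (simp add: z_def cmod_power2)
  have "A * cos (Arg z) + B * sin (Arg z) = cmod z * ((sin (Arg z))\<^sup>2 + (cos (Arg z))\<^sup>2)"
    using A B by algebra
  then have le: "cmod z \<le> K"
    using assms(1)[of "Arg z"] by simp
  then show "0 \<le> K"
    using norm_ge_zero order_trans by blast
  have "K\<^sup>2 + (A * sin s - B * cos s)\<^sup>2 = (A\<^sup>2 + B\<^sup>2) * ((sin s)\<^sup>2 + (cos s)\<^sup>2)"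
    unfolding assms(2)[symmetric] by algebra
  then have "K\<^sup>2 \<le> A\<^sup>2 + B\<^sup>2"
    using zero_le_power2[of "A * sin s - B * cos s"] by (simp only: sin_cos_squared_add mult_1_right)
  moreover have "(cmod z)\<^sup>2 \<le> K\<^sup>2"
    using le by (simp add: power_mono)
  ultimately show "K\<^sup>2 = A\<^sup>2 + B\<^sup>2"
    using R by simp
qed

text \<open>Rotation by a quarter turn, so \<open>perp x \<bullet> y\<close> is the determinant of
  \<open>x\<close> and \<open>y\<close>. It serves as a test of independence and as a normal to a
  side.\<close>

definition perp :: "real^2 \<Rightarrow> real^2" where
  "perp x = vector [- (x$2), x$1]"

lemma inner_perp:
  "perp x \<bullet> y = x$1 * y$2 - x$2 * y$1"
  by (simp add: perp_def inner_vec_def sum_2)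

lemma inner_real2: "x \<bullet> y = x$1 * y$1 + x$2 * y$2" for x y :: "real^2"
  by (simp add: inner_vec_def sum_2)

lemma inner_perp_self [simp]: "perp x \<bullet> x = 0"
  by (simp add: inner_perp)

lemma inner_perp_power2: "(perp x \<bullet> y)\<^sup>2 = (x \<bullet> x) * (y \<bullet> y) - (x \<bullet> y)\<^sup>2"
  unfolding inner_perp inner_real2[of x] inner_real2[of y] by algebra

text \<open>Parseval's identity, and the determinant in the coordinates of the basis. The latter is
  squared because the basis may have either orientation.\<close>

lemma inner_orthonormal_basis:
  fixes u v :: "real^2"
  assumes "norm u = 1" "norm v = 1" "orthogonal u v"
  shows "x \<bullet> y = (x \<bullet> u) * (y \<bullet> u) + (x \<bullet> v) * (y \<bullet> v)"
    and "(perp x \<bullet> y)\<^sup>2 = ((x \<bullet> u) * (y \<bullet> v) - (x \<bullet> v) * (y \<bullet> u))\<^sup>2"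
proof -
  define w where "w = perp u \<bullet> v"
  have u: "u$1 * u$1 + u$2 * u$2 = 1" and v: "v$1 * v$1 + v$2 * v$2 = 1"
    and uv: "u$1 * v$1 + u$2 * v$2 = 0"
    using assms by (simp_all add: norm_eq_1 orthogonal_def inner_real2)
  \<comment> \<open>The orientation \<open>w\<close> is 1 or -1, and \<open>v\<close> is
    \<open>w\<close> times \<open>perp u\<close>.\<close>
  have w: "w * w = 1" and v1: "v$1 = - w * u$2" and v2: "v$2 = w * u$1"
    unfolding w_def inner_perp using u v uv by algebra+
  have inner: "x \<bullet> y = (x \<bullet> u) * (y \<bullet> u) + (x \<bullet> v) * (y \<bullet> v)" for x y
    unfolding inner_real2 v1 v2 using w u by algebra
  then show "x \<bullet> y = (x \<bullet> u) * (y \<bullet> u) + (x \<bullet> v) * (y \<bullet> v)" .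
  show "(perp x \<bullet> y)\<^sup>2 = ((x \<bullet> u) * (y \<bullet> v) - (x \<bullet> v) * (y \<bullet> u))\<^sup>2"
    unfolding inner_perp_power2 inner[of x x] inner[of y y] inner[of x y] by algebra
qed

section \<open>Supporting lines and semi-axes of an ellipse\<close>

lemma inner_ellipse_path:
  "n \<bullet> ellipse_path c u v a b t = n \<bullet> c + (a * (n \<bullet> u) * cos t + b * (n \<bullet> v) * sin t)"
  by (simp add: ellipse_path_def inner_add_right algebra_simps)

lemma ellipse_withD: "ellipse_with E c u v a b \<Longrightarrow> ellipse E"
  unfolding ellipse_def by blast

text \<open>Along the curve, \<open>n \<bullet> x\<close> is a sinusoid about the value
  \<open>n \<bullet> c\<close> at the centre, so a supporting line with normal \<open>n\<close> is
  off the centre by exactly the amplitude.\<close>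

lemma ellipse_support:
  assumes E: "ellipse_with E c u v a b"
    and le: "\<And>x. x \<in> E \<Longrightarrow> n \<bullet> x \<le> k" and y: "y \<in> E" "n \<bullet> y = k"
  shows "n \<bullet> c \<le> k" "(k - n \<bullet> c)\<^sup>2 = a\<^sup>2 * (n \<bullet> u)\<^sup>2 + b\<^sup>2 * (n \<bullet> v)\<^sup>2"
proof -
  have E': "E = range (ellipse_path c u v a b)"
    using E by (simp add: ellipse_with_def)
  then obtain s where s: "y = ellipse_path c u v a b s"
    using y by blast
  have 1: "(a * (n \<bullet> u)) * cos t + (b * (n \<bullet> v)) * sin t \<le> k - n \<bullet> c" for t
    using le[of "ellipse_path c u v a b t"] unfolding E' inner_ellipse_path by simp
  have 2: "(a * (n \<bullet> u)) * cos s + (b * (n \<bullet> v)) * sin s = k - n \<bullet> c"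
    using y unfolding s inner_ellipse_path by simp
  from trig_polynomial_max[OF 1 2] show "n \<bullet> c \<le> k"
      "(k - n \<bullet> c)\<^sup>2 = a\<^sup>2 * (n \<bullet> u)\<^sup>2 + b\<^sup>2 * (n \<bullet> v)\<^sup>2"
    by (simp_all add: power_mult_distrib)
qed

lemma ellipse_compact:
  assumes "ellipse_with E c u v a b"
  shows "compact E"
proof -
  have "ellipse_path c u v a b t \<in> ellipse_path c u v a b ` {0..2*pi}" for t
  proof -
    obtain s where "s \<in> {0..2*pi}" "cos s = cos t" "sin s = sin t"
      using sincos_total_2pi_le[of "cos t" "sin t"] by auto
    then show ?thesis
      unfolding ellipse_path_def by (intro image_eqI[of _ _ s]) auto
  qed
  then have "E = ellipse_path c u v a b ` {0..2*pi}"
    using assms unfolding ellipse_with_def by blast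
  moreover have "continuous_on {0..2*pi} (ellipse_path c u v a b)"
    unfolding ellipse_path_def by (intro continuous_intros)
  ultimately show ?thesis
    by (simp add: compact_continuous_image)
qed

text \<open>The squared half-width of the curve in direction \<open>n\<close> is
  \<open>a\<^sup>2 (n \<bullet> u)\<^sup>2 + b\<^sup>2 (n \<bullet> v)\<^sup>2\<close>, which does not depend on the chosen axes.\<close>

lemma ellipse_width_unique:
  assumes E: "ellipse_with E c u v a b" and E': "ellipse_with E c' u' v' a' b'"
  shows "a\<^sup>2 * (n \<bullet> u)\<^sup>2 + b\<^sup>2 * (n \<bullet> v)\<^sup>2 = a'\<^sup>2 * (n \<bullet> u')\<^sup>2 + b'\<^sup>2 * (n \<bullet> v')\<^sup>2"
proof -
  have ne: "E \<noteq> {}"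
    using E by (auto simp: ellipse_with_def)
  have "\<exists>y\<in>E. \<forall>x\<in>E. m \<bullet> x \<le> m \<bullet> y" for m
    by (rule continuous_attains_sup[OF ellipse_compact[OF E] ne]) (intro continuous_intros)
  then obtain Y where Y: "\<And>m. Y m \<in> E" "\<And>m x. x \<in> E \<Longrightarrow> m \<bullet> x \<le> m \<bullet> Y m"
    by metis
  note s = ellipse_support[OF E Y(2) Y(1) refl] and s' = ellipse_support[OF E' Y(2) Y(1) refl]
  \<comment> \<open>\<open>k\<close> and \<open>l\<close> are the maxima over \<open>E\<close> in
    directions \<open>n\<close> and \<open>- n\<close>. Either centre lies halfway between the two
    supporting lines, so the centres agree in direction \<open>n\<close>.\<close>
  define k l where "k = n \<bullet> Y n" and "l = - n \<bullet> Y (- n)"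
  have eq: "(k - n \<bullet> c)\<^sup>2 = (l + n \<bullet> c)\<^sup>2" "(k - n \<bullet> c')\<^sup>2 = (l + n \<bullet> c')\<^sup>2"
    and pos: "n \<bullet> c \<le> k" "- (n \<bullet> c) \<le> l" "n \<bullet> c' \<le> k" "- (n \<bullet> c') \<le> l"
    using s[of n] s[of "- n"] s'[of n] s'[of "- n"] by (simp_all add: k_def l_def)
  have "k - n \<bullet> c = l + n \<bullet> c" "k - n \<bullet> c' = l + n \<bullet> c'"
    using eq pos unfolding power2_eq_iff by linarith+
  then have "n \<bullet> c = n \<bullet> c'"
    by simp
  then show ?thesis
    using s(2)[of n] s'(2)[of n] by simp
qed

text \<open>The squared half-width in direction \<open>u\<close> is \<open>a^2\<close>; in the other
  axes it is a weighted mean of \<open>a'^2\<close> and \<open>b'^2\<close>, hence at most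
  \<open>a'^2\<close>. Direction \<open>v\<close> treats \<open>b\<close> likewise. Exchanging the
  descriptions gives equality.\<close>

lemma semi_axes_le:
  assumes E: "ellipse_with E c u v a b" and E': "ellipse_with E c' u' v' a' b'"
  shows "a \<le> a'" "b' \<le> b"
proof -
  have u: "u \<bullet> u = 1" "v \<bullet> v = 1" "u \<bullet> v = 0" "v \<bullet> u = 0" and ab: "0 < b" "b \<le> a"
    using E by (auto simp: ellipse_with_def orthogonal_def norm_eq_1 inner_commute)
  have o: "norm u' = 1" "norm v' = 1" "orthogonal u' v'" and ab': "0 < b'" "b' \<le> a'"
    using E' by (auto simp: ellipse_with_def)
  have sq: "b'\<^sup>2 \<le> a'\<^sup>2"
    using ab' by (simp add: power_mono)
  have 1: "(w \<bullet> u')\<^sup>2 + (w \<bullet> v')\<^sup>2 = w \<bullet> w" for w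
    using inner_orthonormal_basis(1)[OF o, of w w] by (simp add: power2_eq_square)
  have "a\<^sup>2 = a'\<^sup>2 * (u \<bullet> u')\<^sup>2 + b'\<^sup>2 * (u \<bullet> v')\<^sup>2"
    using ellipse_width_unique[OF E E', of u] u by simp
  also have "\<dots> \<le> a'\<^sup>2 * (u \<bullet> u')\<^sup>2 + a'\<^sup>2 * (u \<bullet> v')\<^sup>2"
    using sq by (intro add_left_mono mult_right_mono) auto
  also have "\<dots> = a'\<^sup>2"
    using 1[of u] u by (simp flip: distrib_left)
  finally show "a \<le> a'"
    using ab ab' by (simp add: power2_le_iff_abs_le)
  have "b'\<^sup>2 = b'\<^sup>2 * (v \<bullet> u')\<^sup>2 + b'\<^sup>2 * (v \<bullet> v')\<^sup>2"
    using 1[of v] u by (simp flip: distrib_left)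
  also have "\<dots> \<le> a'\<^sup>2 * (v \<bullet> u')\<^sup>2 + b'\<^sup>2 * (v \<bullet> v')\<^sup>2"
    using sq by (intro add_right_mono mult_right_mono) auto
  also have "\<dots> = b\<^sup>2"
    using ellipse_width_unique[OF E E', of v] u by simp
  finally show "b' \<le> b"
    using ab ab' by (simp add: power2_le_iff_abs_le)
qed

lemma eccentricity_eq:
  assumes "ellipse_with E c u v a b"
  shows "eccentricity E = sqrt (1 - b\<^sup>2 / a\<^sup>2)"
  unfolding eccentricity_def
proof (rule the_equality)
  fix e
  assume "\<exists>c u v a b. ellipse_with E c u v a b \<and> e = sqrt (1 - b\<^sup>2 / a\<^sup>2)"
  then obtain c' u' v' a' b' where
    *: "ellipse_with E c' u' v' a' b'" "e = sqrt (1 - b'\<^sup>2 / a'\<^sup>2)"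
    by blast
  then show "e = sqrt (1 - b\<^sup>2 / a\<^sup>2)"
    using semi_axes_le[OF assms *(1)] semi_axes_le[OF *(1) assms] by simp
qed (use assms in blast)

section \<open>Eccentricity in terms of roundness\<close>

text \<open>It depends only on trace and determinant of the shape matrix, so the extremal ellipses
  can be treated without finding their axes.\<close>

definition roundness :: "real \<Rightarrow> real \<Rightarrow> real" where
  "roundness a b = (a * b / (a\<^sup>2 + b\<^sup>2))\<^sup>2"

lemma roundness_leI:
  assumes "a\<^sup>2 * b\<^sup>2 * d \<le> D * (a\<^sup>2 + b\<^sup>2)\<^sup>2" "0 < d" "b \<noteq> 0"
  shows "roundness a b \<le> D / d"
proof -
  have "0 < (a\<^sup>2 + b\<^sup>2)\<^sup>2"
    using assms(3) by (simp add: sum_power2_eq_zero_iff)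
  then show ?thesis
    using assms(1,2) by (simp add: roundness_def power_divide power_mult_distrib
        pos_divide_le_eq pos_le_divide_eq)
qed

text \<open>With \<open>r = b / a\<close> in (0, 1], roundness is the square of r / (1 + r^2), which
  increases there because a difference of two values has the sign of
  \<open>(r' - r) * (1 - r * r')\<close>.\<close>

lemma eccentricity_le_iff:
  assumes E: "ellipse_with E c u v a b" and E': "ellipse_with E' c' u' v' a' b'"
  shows "eccentricity E \<le> eccentricity E' \<longleftrightarrow> roundness a' b' \<le> roundness a b"
proof -
  have ab: "0 < b" "b \<le> a" "0 < b'" "b' \<le> a'"
    using E E' by (auto simp: ellipse_with_def)
  define r r' where "r = b / a" and "r' = b' / a'"
  have r: "0 < r" "r \<le> 1" "0 < r'" "r' \<le> 1"
    using ab by (auto simp: r_def r'_def)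
  have round: "roundness a b = (r / (1 + r\<^sup>2))\<^sup>2" "roundness a' b' = (r' / (1 + r'\<^sup>2))\<^sup>2"
    using ab by (auto simp: roundness_def r_def r'_def field_simps power2_eq_square)
  have pos: "0 < 1 + r\<^sup>2" "0 < 1 + r'\<^sup>2"
    by (auto intro: add_pos_nonneg)
  have "roundness a' b' \<le> roundness a b \<longleftrightarrow> r' / (1 + r'\<^sup>2) \<le> r / (1 + r\<^sup>2)"
    unfolding round using r pos by (subst power_mono_iff) auto
  also have "\<dots> \<longleftrightarrow> r' * (1 + r\<^sup>2) \<le> r * (1 + r'\<^sup>2)"
    using pos by (simp add: divide_le_eq le_divide_eq field_simps)
  also have "\<dots> \<longleftrightarrow> (r' - r) * (1 - r * r') \<le> 0"
    by (simp add: algebra_simps power2_eq_square)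
  also have "\<dots> \<longleftrightarrow> r' \<le> r"
  \<comment> \<open>The second factor vanishes only if both ratios are 1, that is, for two
    circles.\<close>
  proof (cases "r * r' = 1")
    case True
    then have "r = 1 \<and> r' = 1"
      using r by (smt (verit) mult_less_cancel_left_pos mult_left_le mult_le_cancel_left1)
    then show ?thesis by simp
  next
    case False
    then have "0 < 1 - r * r'"
      using r by (smt (verit) mult_le_one)
    then show ?thesis
      by (simp add: mult_le_0_iff)
  qed
  also have "\<dots> \<longleftrightarrow> r'\<^sup>2 \<le> r\<^sup>2"
    using r by (simp add: power_mono_iff)
  also have "\<dots> \<longleftrightarrow> eccentricity E \<le> eccentricity E'"
    unfolding eccentricity_eq[OF E] eccentricity_eq[OF E'] r_def r'_def
    by (simp add: power_divide)
  finally show ?thesis by blast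
qed

text \<open>An attained upper bound on roundness is an attained lower bound on eccentricity. Since
  the minimisers are described by their eccentricity, \<open>bielliptic\<close> comes down to
  comparing one witness from each class.\<close>

lemma is_arg_min_eccentricity_iff:
  assumes max: "\<And>E c u v a b. Q E \<Longrightarrow> ellipse_with E c u v a b \<Longrightarrow> roundness a b \<le> K"
    and Q: "\<And>E. Q E \<Longrightarrow> ellipse E"
    and E0: "Q E0" "ellipse_with E0 c0 u0 v0 a0 b0" "roundness a0 b0 = K"
  shows "is_arg_min eccentricity Q E \<longleftrightarrow> Q E \<and> eccentricity E = eccentricity E0"
proof -
  have "eccentricity E0 \<le> eccentricity E'" if QE': "Q E'" for E'
  proof -
    obtain c u v a b where "ellipse_with E' c u v a b"
      using Q[OF QE'] unfolding ellipse_def by blast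
    then show ?thesis
      using max[OF QE'] E0 eccentricity_le_iff by metis
  qed
  then show ?thesis
    using E0(1) unfolding is_arg_min_def by (metis linorder_not_less order_antisym)
qed

section \<open>Ellipses given by conjugate diameters\<close>

text \<open>\<open>p\<close> and \<open>q\<close> are conjugate half-diameters. A parameter shift
  keeps the sum of their squared lengths and their determinant (Apollonius), and a suitable one
  makes them orthogonal. The shift \<open>t0\<close> is kept because tangency is defined through
  \<open>ellipse_path\<close>.\<close>

lemma ellipse_conjugate_diameters:
  fixes p q M :: "real^2"
  assumes ind: "perp p \<bullet> q \<noteq> 0"
  obtains u v a b t0 where
    "ellipse_with (range (\<lambda>t. M + cos t *\<^sub>R p + sin t *\<^sub>R q)) M u v a b"
    "\<And>t. ellipse_path M u v a b t = M + cos (t + t0) *\<^sub>R p + sin (t + t0) *\<^sub>R q"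
    "a\<^sup>2 + b\<^sup>2 = p \<bullet> p + q \<bullet> q" "(a * b)\<^sup>2 = (perp p \<bullet> q)\<^sup>2"
proof -
  \<comment> \<open>Rotating the parameter by \<open>s\<close> diagonalises the shape matrix; taking \<open>2 s\<close> as the argument of
    \<open>z\<close> makes the first axis the longer one.\<close>
  define z where "z = Complex (p \<bullet> p - q \<bullet> q) (2 * (p \<bullet> q))"
  define s where "s = Arg z / 2"
  have A: "p \<bullet> p - q \<bullet> q = cmod z * cos (2 * s)" and B: "2 * (p \<bullet> q) = cmod z * sin (2 * s)"
    unfolding s_def
    by (simp_all, metis z_def complex.sel rcis_cmod_Arg Re_rcis,
        metis z_def complex.sel rcis_cmod_Arg Im_rcis)
  define p' q' where "p' = cos s *\<^sub>R p + sin s *\<^sub>R q" and "q' = - sin s *\<^sub>R p + cos s *\<^sub>R q"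
  have one: "(sin x)\<^sup>2 + (cos x)\<^sup>2 = 1" for x :: real by simp
  have ip: "p' \<bullet> p' = (cos s)\<^sup>2 * (p \<bullet> p) + 2 * sin s * cos s * (p \<bullet> q) + (sin s)\<^sup>2 * (q \<bullet> q)"
    and iq: "q' \<bullet> q' = (sin s)\<^sup>2 * (p \<bullet> p) - 2 * sin s * cos s * (p \<bullet> q) + (cos s)\<^sup>2 * (q \<bullet> q)"
    and ipq: "p' \<bullet> q' = - sin s * cos s * (p \<bullet> p - q \<bullet> q) + ((cos s)\<^sup>2 - (sin s)\<^sup>2) * (p \<bullet> q)"
    by (simp_all add: p'_def q'_def inner_add_left inner_add_right inner_diff_left inner_diff_right
        algebra_simps power2_eq_square inner_commute[of q p])
  \<comment> \<open>The difference of the squared lengths of \<open>p'\<close> and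
    \<open>q'\<close>, and twice their inner product, are the real and imaginary parts of
    \<open>z\<close> turned by \<open>- 2 * s\<close>, which is the real number
    \<open>cmod z\<close>.\<close>
  have "2 * (p' \<bullet> q') = - sin (2 * s) * (p \<bullet> p - q \<bullet> q) + cos (2 * s) * (2 * (p \<bullet> q))"
    unfolding ipq sin_double cos_double by algebra
  then have orth: "p' \<bullet> q' = 0"
    unfolding A B by simp
  have "p' \<bullet> p' - q' \<bullet> q' = cos (2 * s) * (p \<bullet> p - q \<bullet> q) + sin (2 * s) * (2 * (p \<bullet> q))"
    unfolding ip iq sin_double cos_double by algebra
  also have "\<dots> = cmod z * ((sin (2 * s))\<^sup>2 + (cos (2 * s))\<^sup>2)"
    unfolding A B by algebra
  finally have ge: "q' \<bullet> q' \<le> p' \<bullet> p'"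
    unfolding one using norm_ge_zero[of z] by linarith
  have trace: "p' \<bullet> p' + q' \<bullet> q' = p \<bullet> p + q \<bullet> q"
    unfolding ip iq using one[of s] by algebra
  have "perp p' \<bullet> q' = ((sin s)\<^sup>2 + (cos s)\<^sup>2) * (perp p \<bullet> q)"
    unfolding inner_perp p'_def q'_def vector_add_component vector_scaleR_component real_scaleR_def
    by algebra
  then have det: "perp p' \<bullet> q' = perp p \<bullet> q"
    by simp
  have ne: "p' \<noteq> 0" "q' \<noteq> 0"
    using det ind by (auto simp: inner_perp)
  define u v where "u = p' /\<^sub>R norm p'" and "v = q' /\<^sub>R norm q'"
  have path: "ellipse_path M u v (norm p') (norm q') t
      = M + cos (t + s) *\<^sub>R p + sin (t + s) *\<^sub>R q" for t
  proof -
    have "ellipse_path M u v (norm p') (norm q') t = M + cos t *\<^sub>R p' + sin t *\<^sub>R q'"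
      using ne by (simp add: ellipse_path_def u_def v_def mult.commute[of _ "cos t"]
          mult.commute[of _ "sin t"] mult.assoc)
    also have "\<dots> = M + cos (t + s) *\<^sub>R p + sin (t + s) *\<^sub>R q"
      by (simp add: p'_def q'_def cos_add sin_add algebra_simps)
    finally show ?thesis .
  qed
  have "range (\<lambda>t. M + cos t *\<^sub>R p + sin t *\<^sub>R q) = range (ellipse_path M u v (norm p') (norm q'))"
  proof -
    have "range (\<lambda>t. M + cos t *\<^sub>R p + sin t *\<^sub>R q)
        = (\<lambda>t. M + cos t *\<^sub>R p + sin t *\<^sub>R q) ` range (\<lambda>t. t + s)"
      by simp
    also have "\<dots> = range (ellipse_path M u v (norm p') (norm q'))"
      unfolding image_image path ..
    finally show ?thesis .
  qed
  then have "ellipse_with (range (\<lambda>t. M + cos t *\<^sub>R p + sin t *\<^sub>R q)) M u v (norm p') (norm q')"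
    using ne ge orth by (simp add: ellipse_with_def u_def v_def orthogonal_def norm_le)
  moreover have "(norm p')\<^sup>2 + (norm q')\<^sup>2 = p \<bullet> p + q \<bullet> q"
    using trace by (simp add: power2_norm_eq_inner)
  moreover have "(norm p' * norm q')\<^sup>2 = (perp p \<bullet> q)\<^sup>2"
    unfolding det[symmetric] inner_perp_power2[of p'] orth
    by (simp add: power_mult_distrib power2_norm_eq_inner)
  ultimately show thesis
    using path that by blast
qed

text \<open>Transfers tangency to conjugate diameters: parameter \<open>t\<close> there is
  \<open>t - t0\<close> on \<open>ellipse_path\<close>. The number \<open>r\<close> places the
  contact point on the segment, and \<open>k\<close> compares the velocity with the side.\<close>

lemma tangent_to_segmentI:
  fixes p q M :: "real^2"
  assumes ind: "perp p \<bullet> q \<noteq> 0"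
    and pt: "M + cos t *\<^sub>R p + sin t *\<^sub>R q = X + r *\<^sub>R (Y - X)" "0 \<le> r" "r \<le> 1"
    and deriv: "- sin t *\<^sub>R p + cos t *\<^sub>R q = k *\<^sub>R (Y - X)" "k \<noteq> 0"
  shows "tangent_to_segment (range (\<lambda>t. M + cos t *\<^sub>R p + sin t *\<^sub>R q)) X Y"
proof -
  obtain u v a b t0 where
    E: "ellipse_with (range (\<lambda>t. M + cos t *\<^sub>R p + sin t *\<^sub>R q)) M u v a b"
    and path: "\<And>t. ellipse_path M u v a b t = M + cos (t + t0) *\<^sub>R p + sin (t + t0) *\<^sub>R q"
    and "a\<^sup>2 + b\<^sup>2 = p \<bullet> p + q \<bullet> q" "(a * b)\<^sup>2 = (perp p \<bullet> q)\<^sup>2"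
    using ellipse_conjugate_diameters[OF ind, where M = M] by blast
  have pt': "ellipse_path M u v a b (t - t0) = X + r *\<^sub>R (Y - X)"
    unfolding path using pt by simp
  have "(ellipse_path M u v a b has_vector_derivative
      (- sin (t - t0 + t0) *\<^sub>R p + cos (t - t0 + t0) *\<^sub>R q)) (at (t - t0))"
    unfolding path[abs_def] by (auto intro!: derivative_eq_intros)
  then have d: "vector_derivative (ellipse_path M u v a b) (at (t - t0)) = k *\<^sub>R (Y - X)"
    using deriv by (simp add: vector_derivative_at)
  have "affine hull {X, Y} = range (\<lambda>s. X + s *\<^sub>R (Y - X))"
    unfolding affine_hull_2_alt by (simp add: algebra_simps)
  \<comment> \<open>The line is reparametrised to start at the contact point with velocity
    \<open>k\<close>; this is onto as \<open>k\<close> is nonzero.\<close>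
  also have "\<dots> = (\<lambda>s. X + s *\<^sub>R (Y - X)) ` range (\<lambda>s. r + s * k)"
  proof -
    have "surj (\<lambda>s. r + s * k)"
      using deriv(2) by (intro surjI[where f = "\<lambda>y. (y - r) / k"]) simp
    then show ?thesis by simp
  qed
  also have "\<dots> = range (\<lambda>s. X + r *\<^sub>R (Y - X) + s *\<^sub>R k *\<^sub>R (Y - X))"
    unfolding image_image by (simp add: scaleR_add_left add.assoc)
  finally have aff: "affine hull {X, Y} = \<dots>" .
  have "X + r *\<^sub>R (Y - X) \<in> closed_segment X Y"
    unfolding closed_segment_def using pt by (auto intro!: exI[of _ r] simp: algebra_simps)
  then show ?thesis
    unfolding tangent_to_segment_def using E pt' d aff
    by (intro exI[of _ M] exI[of _ u] exI[of _ v] exI[of _ a] exI[of _ b] exI[of _ "t - t0"]) simp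
qed

text \<open>Convexity is used three times: for a point on each of two opposite sides, and then for a
  point between these.\<close>

lemma parallelogram_subset_hull:
  fixes p q M :: "real^2"
  assumes "\<bar>x\<bar> \<le> 1" "\<bar>y\<bar> \<le> 1"
  shows "M + x *\<^sub>R p + y *\<^sub>R q \<in> convex hull {M - p - q, M + p - q, M + p + q, M - p + q}"
    (is "_ \<in> convex hull ?V")
proof -
  have seg: "w + z *\<^sub>R d \<in> S" if "convex S" "w - d \<in> S" "w + d \<in> S" "\<bar>z\<bar> \<le> 1"
    for w d :: "real^2" and z S
  proof -
    have "w + z *\<^sub>R d = ((1 - z) / 2) *\<^sub>R (w - d) + ((1 + z) / 2) *\<^sub>R (w + d)"
      by (simp add: vec_eq_iff) (simp add: field_simps)
    moreover have "\<dots> \<in> S"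
      using that(4) by (intro convexD[OF that(1-3)]) (auto simp: abs_le_iff field_simps)
    ultimately show ?thesis
      by simp
  qed
  have cv: "convex (convex hull ?V)"
    by (rule convex_convex_hull)
  have V: "w \<in> convex hull ?V" if "w \<in> ?V" for w
    using that by (rule hull_inc)
  have 1: "(M - q) + x *\<^sub>R p \<in> convex hull ?V"
    by (rule seg[OF cv V V assms(1)]) (simp_all add: algebra_simps)
  have 2: "(M + q) + x *\<^sub>R p \<in> convex hull ?V"
    by (rule seg[OF cv V V assms(1)]) (simp_all add: algebra_simps)
  show ?thesis
    by (rule seg[OF cv _ _ assms(2)]) (use 1 2 in \<open>simp_all add: algebra_simps\<close>)
qed


lemma circumscribed_roundness_le:
  fixes p q M :: "real^2"
  assumes ind: "perp p \<bullet> q \<noteq> 0"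
    and circ: "circumscribed (M - p - q) (M + p - q) (M + p + q) (M - p + q) E"
    and E: "ellipse_with E c u v a b"
  shows "roundness a b \<le> (perp p \<bullet> q)\<^sup>2 / (4 * (p \<bullet> p) * (q \<bullet> q))"
proof -
  have o: "norm u = 1" "norm v = 1" "orthogonal u v" and ab: "0 < b" "b \<le> a"
    using E by (auto simp: ellipse_with_def)
  then have uv: "u \<bullet> u = 1" "v \<bullet> v = 1" "u \<bullet> v = 0" "v \<bullet> u = 0"
    by (auto simp: orthogonal_def norm_eq_1 inner_commute)
  have a: "a \<noteq> 0" "b \<noteq> 0" using ab by auto
  have eqn: "((x - c) \<bullet> u / a)\<^sup>2 + ((x - c) \<bullet> v / b)\<^sup>2 = 1" if x: "x \<in> E" for x
  proof -
    obtain t where "x = ellipse_path c u v a b t"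
      using x E unfolding ellipse_with_def by blast
    then show ?thesis
      using uv a by (simp add: ellipse_path_def inner_add_left)
  qed
  \<comment> \<open>In coordinates in which the ellipse is the unit circle, the parallelogram is a rectangle.\<close>
  define p1 p2 q1 q2 m1 m2 where defs: "p1 = p \<bullet> u / a" "p2 = p \<bullet> v / b" "q1 = q \<bullet> u / a"
    "q2 = q \<bullet> v / b" "m1 = (M - c) \<bullet> u / a" "m2 = (M - c) \<bullet> v / b"
  have "(m1 - p1 - q1)\<^sup>2 + (m2 - p2 - q2)\<^sup>2 = 1" "(m1 + p1 - q1)\<^sup>2 + (m2 + p2 - q2)\<^sup>2 = 1"
    "(m1 + p1 + q1)\<^sup>2 + (m2 + p2 + q2)\<^sup>2 = 1" "(m1 - p1 + q1)\<^sup>2 + (m2 - p2 + q2)\<^sup>2 = 1"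
    using eqn[of "M - p - q"] eqn[of "M + p - q"] eqn[of "M + p + q"] eqn[of "M - p + q"] circ
    by (simp_all add: circumscribed_def defs inner_add_left inner_diff_left
        diff_divide_distrib add_divide_distrib algebra_simps)
  \<comment> \<open>The alternating sum of the four equations is 8 times this inner product.\<close>
  then have orth: "p1 * q1 + p2 * q2 = 0"
    by algebra
  have pu: "p \<bullet> u = a * p1" "p \<bullet> v = b * p2" "q \<bullet> u = a * q1" "q \<bullet> v = b * q2"
    using a by (simp_all add: defs)
  define \<alpha> \<beta> where "\<alpha> = p1\<^sup>2 + p2\<^sup>2" and "\<beta> = q1\<^sup>2 + q2\<^sup>2"
  have P: "p \<bullet> p = a\<^sup>2 * p1\<^sup>2 + b\<^sup>2 * p2\<^sup>2" and Q: "q \<bullet> q = a\<^sup>2 * q1\<^sup>2 + b\<^sup>2 * q2\<^sup>2"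
    unfolding inner_orthonormal_basis(1)[OF o, of p p] inner_orthonormal_basis(1)[OF o, of q q] pu
    by (simp_all add: power2_eq_square)
  have D: "(perp p \<bullet> q)\<^sup>2 = a\<^sup>2 * b\<^sup>2 * (\<alpha> * \<beta>)"
    unfolding inner_orthonormal_basis(2)[OF o] pu \<alpha>_def \<beta>_def using orth by algebra
  have nonneg: "0 \<le> \<alpha> * \<beta>"
    unfolding \<alpha>_def \<beta>_def by simp
  with D ind have pos: "0 < \<alpha> * \<beta>"
    by (metis less_eq_real_def mult_zero_right power_eq_0_iff)
  \<comment> \<open>This is the trace multiplied by \<open>\<alpha> * \<beta>\<close>: the
    normalised images of \<open>p\<close> and \<open>q\<close> are orthonormal, so p1^2 / \<alpha> +
    q1^2 / \<beta> = 1, and likewise for \<open>p2\<close> and \<open>q2\<close>.\<close>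
  have sum_eq: "(p \<bullet> p) * \<beta> + (q \<bullet> q) * \<alpha> = \<alpha> * \<beta> * (a\<^sup>2 + b\<^sup>2)"
    unfolding P Q \<alpha>_def \<beta>_def using orth by algebra
  have amgm: "4 * x * y \<le> (x + y)\<^sup>2" for x y :: real
    using zero_le_power2[of "x - y"] by (simp add: power2_eq_square algebra_simps)
  from sum_eq have "4 * ((p \<bullet> p) * \<beta>) * ((q \<bullet> q) * \<alpha>) \<le> (\<alpha> * \<beta> * (a\<^sup>2 + b\<^sup>2))\<^sup>2"
    using amgm[of "(p \<bullet> p) * \<beta>" "(q \<bullet> q) * \<alpha>"] by simp
  then have "\<alpha> * \<beta> * (4 * (p \<bullet> p) * (q \<bullet> q)) \<le> \<alpha> * \<beta> * (\<alpha> * \<beta> * (a\<^sup>2 + b\<^sup>2)\<^sup>2)"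
    by (simp add: power2_eq_square algebra_simps)
  then have "4 * (p \<bullet> p) * (q \<bullet> q) \<le> \<alpha> * \<beta> * (a\<^sup>2 + b\<^sup>2)\<^sup>2"
    using pos mult_le_cancel_left_pos by blast
  then have "a\<^sup>2 * b\<^sup>2 * (4 * (p \<bullet> p) * (q \<bullet> q)) \<le> (perp p \<bullet> q)\<^sup>2 * (a\<^sup>2 + b\<^sup>2)\<^sup>2"
    unfolding D by (simp add: mult.assoc mult_left_mono)
  moreover have "0 < 4 * (p \<bullet> p) * (q \<bullet> q)"
    using ind by (intro mult_pos_pos) (auto simp: inner_perp)
  ultimately show ?thesis
    using a by (intro roundness_leI)
qed

lemma circumscribed_roundness_attained:
  fixes p q M :: "real^2"
  assumes ind: "perp p \<bullet> q \<noteq> 0"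
  obtains E c u v a b where
    "circumscribed (M - p - q) (M + p - q) (M + p + q) (M - p + q) E"
    "ellipse_with E c u v a b" "roundness a b = (perp p \<bullet> q)\<^sup>2 / (4 * (p \<bullet> p) * (q \<bullet> q))"
proof -
  define P Q where "P = p \<bullet> p" and "Q = q \<bullet> q"
  have pos: "0 < P" "0 < Q"
    using ind by (auto simp: inner_perp P_def Q_def)
  \<comment> \<open>Equality in AM-GM requires \<alpha> : \<beta> = P : Q; with sum 1 this fixes the
    squares of \<open>x\<close> and \<open>y\<close>.\<close>
  define x y where "x = sqrt (P / (P + Q))" and "y = sqrt (Q / (P + Q))"
  have xy: "x\<^sup>2 = P / (P + Q)" "y\<^sup>2 = Q / (P + Q)" "0 < x" "0 < y"
    using pos by (auto simp: x_def y_def)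
  then have "x\<^sup>2 + y\<^sup>2 = 1"
    using pos by (simp flip: add_divide_distrib)
  then obtain \<theta> where \<theta>: "x = cos \<theta>" "y = sin \<theta>"
    using sincos_total_2pi by metis
  define p' q' where "p' = p /\<^sub>R x" and "q' = q /\<^sub>R y"
  define E where "E = range (\<lambda>t. M + cos t *\<^sub>R p' + sin t *\<^sub>R q')"
  have p': "cos \<theta> *\<^sub>R p' = p" "sin \<theta> *\<^sub>R q' = q"
    using xy by (auto simp: p'_def q'_def \<theta>[symmetric])
  have det: "perp p' \<bullet> q' = (perp p \<bullet> q) / (x * y)"
    by (simp add: inner_perp p'_def q'_def divide_inverse algebra_simps)
  then have "perp p' \<bullet> q' \<noteq> 0"
    using ind xy by simp
  then obtain u v a b t0 where
    ell: "ellipse_with E M u v a b"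
    and "\<And>t. ellipse_path M u v a b t = M + cos (t + t0) *\<^sub>R p' + sin (t + t0) *\<^sub>R q'"
    and trace: "a\<^sup>2 + b\<^sup>2 = p' \<bullet> p' + q' \<bullet> q'" and ab: "(a * b)\<^sup>2 = (perp p' \<bullet> q')\<^sup>2"
    unfolding E_def using ellipse_conjugate_diameters[where M = M] by blast
  have mem: "M + cos t *\<^sub>R p' + sin t *\<^sub>R q' \<in> E" for t
    by (auto simp: E_def)
  \<comment> \<open>The vertices have parameters \<open>\<theta>\<close>,
    \<open>pi - \<theta>\<close>, \<open>- \<theta>\<close> and
    \<open>\<theta> + pi\<close>.\<close>
  have "circumscribed (M - p - q) (M + p - q) (M + p + q) (M - p + q) E"
    using ellipse_withD[OF ell] mem[of \<theta>] mem[of "pi - \<theta>"] mem[of "- \<theta>"] mem[of "\<theta> + pi"]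
    by (simp add: circumscribed_def p')
  moreover have "roundness a b = (perp p \<bullet> q)\<^sup>2 / (4 * P * Q)"
  proof -
    have "p' \<bullet> p' = P / x\<^sup>2" "q' \<bullet> q' = Q / y\<^sup>2"
      by (simp_all add: p'_def q'_def P_def Q_def power2_eq_square field_simps)
    then have ab_sum: "a\<^sup>2 + b\<^sup>2 = 2 * (P + Q)"
      unfolding trace xy using pos by simp
    have ab_prod: "(a * b)\<^sup>2 = (perp p \<bullet> q)\<^sup>2 * (P + Q)\<^sup>2 / (P * Q)"
      unfolding ab det unfolding power_divide power_mult_distrib xy using pos
      by (simp add: power2_eq_square field_simps)
    show ?thesis
      unfolding roundness_def power_divide ab_sum ab_prod unfolding power_mult_distrib using pos
      by simp
  qed
  ultimately show thesis
    using that ell by (simp add: P_def Q_def)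
qed

section \<open>Inscribed ellipses\<close>

text \<open>\<open>n\<close> is normal to two opposite sides. The curve stays in the strip between
  their lines and touches both, so its centre is level with \<open>M\<close> and its half-width is
  that of the strip. The sign of \<open>d\<close> is left open, as it depends on the
  orientation.\<close>

lemma inscribed_half_width:
  assumes E: "ellipse_with E c u v a b" and hull: "E \<subseteq> convex hull S"
    and S: "\<And>x. x \<in> S \<Longrightarrow> \<bar>n \<bullet> (x - M)\<bar> \<le> \<bar>d\<bar>"
    and side: "tangent_to_segment E X Y" "n \<bullet> X = n \<bullet> M + d" "n \<bullet> Y = n \<bullet> M + d"
    and opp: "tangent_to_segment E X' Y'" "n \<bullet> X' = n \<bullet> M - d" "n \<bullet> Y' = n \<bullet> M - d"
  shows "d\<^sup>2 = a\<^sup>2 * (n \<bullet> u)\<^sup>2 + b\<^sup>2 * (n \<bullet> v)\<^sup>2"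
proof -
  have touch: "\<exists>y\<in>E. n \<bullet> y = k" if tan: "tangent_to_segment E X Y" and nk: "n \<bullet> X = k" "n \<bullet> Y = k"
    for X Y k
  proof -
    obtain y where y: "y \<in> E" "y \<in> closed_segment X Y"
      using tan unfolding tangent_to_segment_def ellipse_with_def by blast
    obtain r where "y = (1 - r) *\<^sub>R X + r *\<^sub>R Y"
      using y(2) unfolding closed_segment_def by blast
    then have "n \<bullet> y = k"
      using nk by (simp add: inner_add_right) (simp add: algebra_simps)
    with y show ?thesis by blast
  qed
  have le: "m \<bullet> x \<le> m \<bullet> M + \<bar>d\<bar>" if x: "x \<in> E" and m: "m = n \<or> m = - n" for m x
  proof -
    have "m \<bullet> z \<le> m \<bullet> M + \<bar>d\<bar>" if "z \<in> S" for z
      using S[OF that] m by (auto simp: inner_diff_right)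
    then have "convex hull S \<subseteq> {z. m \<bullet> z \<le> m \<bullet> M + \<bar>d\<bar>}"
      by (intro hull_minimal convex_halfspace_le) auto
    then show ?thesis
      using x hull by blast
  qed
  have "\<exists>y\<in>E. n \<bullet> y = n \<bullet> M + \<bar>d\<bar>" "\<exists>y\<in>E. n \<bullet> y = n \<bullet> M - \<bar>d\<bar>"
    using touch[OF side] touch[OF opp] by (cases "0 \<le> d"; simp)+
  then obtain y y' where y: "y \<in> E" "n \<bullet> y = n \<bullet> M + \<bar>d\<bar>"
    and y': "y' \<in> E" "- n \<bullet> y' = - n \<bullet> M + \<bar>d\<bar>"
    by auto
  from ellipse_support[OF E le y] ellipse_support[OF E le y']
  have s: "n \<bullet> c \<le> n \<bullet> M + \<bar>d\<bar>" "- (n \<bullet> c) \<le> - (n \<bullet> M) + \<bar>d\<bar>"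
      "(n \<bullet> M + \<bar>d\<bar> - n \<bullet> c)\<^sup>2 = a\<^sup>2 * (n \<bullet> u)\<^sup>2 + b\<^sup>2 * (n \<bullet> v)\<^sup>2"
      "(- (n \<bullet> M) + \<bar>d\<bar> + n \<bullet> c)\<^sup>2 = a\<^sup>2 * (n \<bullet> u)\<^sup>2 + b\<^sup>2 * (n \<bullet> v)\<^sup>2"
    by simp_all
  then have "(n \<bullet> M + \<bar>d\<bar> - n \<bullet> c)\<^sup>2 = (- (n \<bullet> M) + \<bar>d\<bar> + n \<bullet> c)\<^sup>2"
    by simp
  then have "n \<bullet> M = n \<bullet> c"
    using s(1,2) unfolding power2_eq_iff by linarith
  then show ?thesis
    using s(3) by simp
qed

lemma inscribed_denominator_pos:
  fixes p q :: "real^2"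
  assumes "perp p \<bullet> q \<noteq> 0"
  shows "0 < (p \<bullet> p + q \<bullet> q)\<^sup>2 - 4 * (p \<bullet> q)\<^sup>2"
proof -
  have "(p \<bullet> p + q \<bullet> q)\<^sup>2 - 4 * (p \<bullet> q)\<^sup>2 = (p \<bullet> p - q \<bullet> q)\<^sup>2 + 4 * (perp p \<bullet> q)\<^sup>2"
    unfolding inner_perp_power2 by algebra
  then show ?thesis
    using assms by (simp add: add_nonneg_pos)
qed

text \<open>The half-widths in directions \<open>perp p\<close> and \<open>perp q\<close> fix the
  diagonal entries of the shape matrix in the basis \<open>p\<close>, \<open>q\<close>. Only the
  off-diagonal entry is free, and the bound follows by completing a square in it.\<close>

lemma inscribed_roundness_le:
  fixes p q M :: "real^2"
  assumes ind: "perp p \<bullet> q \<noteq> 0"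
    and ins: "inscribed (M - p - q) (M + p - q) (M + p + q) (M - p + q) E"
    and E: "ellipse_with E c u v a b"
  shows "roundness a b \<le> (perp p \<bullet> q)\<^sup>2 / ((p \<bullet> p + q \<bullet> q)\<^sup>2 - 4 * (p \<bullet> q)\<^sup>2)"
proof -
  have o: "norm u = 1" "norm v = 1" "orthogonal u v" and ab: "0 < b" "b \<le> a"
    using E by (auto simp: ellipse_with_def)
  then have uv: "u \<bullet> u = 1" "v \<bullet> v = 1" "u \<bullet> v = 0"
    by (auto simp: orthogonal_def norm_eq_1)
  have hull: "E \<subseteq> convex hull {M - p - q, M + p - q, M + p + q, M - p + q}"
    and tan: "tangent_to_segment E (M - p - q) (M + p - q)"
      "tangent_to_segment E (M + p - q) (M + p + q)"
      "tangent_to_segment E (M + p + q) (M - p + q)"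
      "tangent_to_segment E (M - p + q) (M - p - q)"
    using ins by (auto simp: inscribed_def)
  define \<Delta> where "\<Delta> = perp p \<bullet> q"
  have flip: "perp q \<bullet> p = - \<Delta>"
    by (simp add: \<Delta>_def inner_perp)
  \<comment> \<open>A quarter turn exchanges the two coordinates up to sign.\<close>
  have perp: "(perp x \<bullet> u)\<^sup>2 = (x \<bullet> v)\<^sup>2" "(perp x \<bullet> v)\<^sup>2 = (x \<bullet> u)\<^sup>2" for x
    using inner_orthonormal_basis(2)[OF o, of x u] inner_orthonormal_basis(2)[OF o, of x v] uv
    by (simp_all add: inner_commute[of v u])
  have "(- \<Delta>)\<^sup>2 = a\<^sup>2 * (perp q \<bullet> u)\<^sup>2 + b\<^sup>2 * (perp q \<bullet> v)\<^sup>2"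
    by (rule inscribed_half_width[OF E hull _ tan(2) _ _ tan(4), of _ M])
      (auto simp: inner_add_right inner_diff_right flip)
  then have wq: "\<Delta>\<^sup>2 = a\<^sup>2 * (q \<bullet> v)\<^sup>2 + b\<^sup>2 * (q \<bullet> u)\<^sup>2"
    by (simp add: perp)
  have "\<Delta>\<^sup>2 = a\<^sup>2 * (perp p \<bullet> u)\<^sup>2 + b\<^sup>2 * (perp p \<bullet> v)\<^sup>2"
    by (rule inscribed_half_width[OF E hull _ tan(3) _ _ tan(1), of _ M])
      (auto simp: inner_add_right inner_diff_right \<Delta>_def)
  then have wp: "\<Delta>\<^sup>2 = a\<^sup>2 * (p \<bullet> v)\<^sup>2 + b\<^sup>2 * (p \<bullet> u)\<^sup>2"
    by (simp add: perp)
  \<comment> \<open>\<open>\<sigma> = \<rho> \<Delta>\<^sup>2\<close>, with \<open>\<rho>\<close> the off-diagonal entry of the shape matrix in the basis \<open>p, q\<close>.\<close>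
  define T G \<sigma> where "T = p \<bullet> p + q \<bullet> q" and "G = p \<bullet> q"
    and "\<sigma> = - (a\<^sup>2 * (p \<bullet> v) * (q \<bullet> v) + b\<^sup>2 * (p \<bullet> u) * (q \<bullet> u))"
  have \<Delta>2: "\<Delta>\<^sup>2 = ((p \<bullet> u) * (q \<bullet> v) - (p \<bullet> v) * (q \<bullet> u))\<^sup>2"
    unfolding \<Delta>_def by (rule inner_orthonormal_basis(2)[OF o])
  have \<Delta>pos: "0 < \<Delta>\<^sup>2"
    using ind by (simp add: \<Delta>_def)
  have trace: "\<Delta>\<^sup>2 * (a\<^sup>2 + b\<^sup>2) = T * \<Delta>\<^sup>2 + 2 * \<sigma> * G"
  proof -
    have "T * \<Delta>\<^sup>2 = (p \<bullet> p) * (a\<^sup>2 * (q \<bullet> v)\<^sup>2 + b\<^sup>2 * (q \<bullet> u)\<^sup>2)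
        + (q \<bullet> q) * (a\<^sup>2 * (p \<bullet> v)\<^sup>2 + b\<^sup>2 * (p \<bullet> u)\<^sup>2)"
      using wp wq by (simp add: T_def distrib_right)
    then show ?thesis
      unfolding \<Delta>2 \<sigma>_def G_def inner_orthonormal_basis(1)[OF o, of p p]
        inner_orthonormal_basis(1)[OF o, of q q] inner_orthonormal_basis(1)[OF o, of p q]
      by algebra
  qed
  have det: "a\<^sup>2 * b\<^sup>2 * \<Delta>\<^sup>2 = \<Delta>\<^sup>2 * \<Delta>\<^sup>2 - \<sigma>\<^sup>2"
  proof -
    have "\<Delta>\<^sup>2 * \<Delta>\<^sup>2 = (a\<^sup>2 * (q \<bullet> v)\<^sup>2 + b\<^sup>2 * (q \<bullet> u)\<^sup>2) * (a\<^sup>2 * (p \<bullet> v)\<^sup>2 + b\<^sup>2 * (p \<bullet> u)\<^sup>2)"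
      using wp wq by simp
    then show ?thesis
      unfolding \<Delta>2 \<sigma>_def by algebra
  qed
  \<comment> \<open>The gap in the desired inequality is a square, which vanishes exactly for \<rho>
    = - 2 G / T.\<close>
  have "\<Delta>\<^sup>2 * (\<Delta>\<^sup>2 * (a\<^sup>2 + b\<^sup>2)\<^sup>2 - a\<^sup>2 * b\<^sup>2 * (T\<^sup>2 - 4 * G\<^sup>2)) = (2 * \<Delta>\<^sup>2 * G + \<sigma> * T)\<^sup>2"
    using trace det by algebra
  then have "0 \<le> \<Delta>\<^sup>2 * (a\<^sup>2 + b\<^sup>2)\<^sup>2 - a\<^sup>2 * b\<^sup>2 * (T\<^sup>2 - 4 * G\<^sup>2)"
    using \<Delta>pos by (metis zero_le_mult_iff zero_le_power2 not_less)
  then have "a\<^sup>2 * b\<^sup>2 * (T\<^sup>2 - 4 * G\<^sup>2) \<le> \<Delta>\<^sup>2 * (a\<^sup>2 + b\<^sup>2)\<^sup>2"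
    by simp
  moreover have "0 < T\<^sup>2 - 4 * G\<^sup>2"
    unfolding T_def G_def by (rule inscribed_denominator_pos[OF ind])
  ultimately have "roundness a b \<le> \<Delta>\<^sup>2 / (T\<^sup>2 - 4 * G\<^sup>2)"
    using ab by (intro roundness_leI) auto
  then show ?thesis
    by (simp add: T_def G_def \<Delta>_def)
qed

text \<open>The witness is \<open>M + cos t *\<^sub>R p + cos (t - \<phi>) *\<^sub>R q\<close> with
  cos \<phi> = \<rho> the optimal entry. Both coefficients stay between -1 and 1, and a side is
  touched whenever one of them is extremal.\<close>

lemma inscribed_roundness_attained:
  fixes p q M :: "real^2"
  assumes ind: "perp p \<bullet> q \<noteq> 0"
  obtains E c u v a b where
    "inscribed (M - p - q) (M + p - q) (M + p + q) (M - p + q) E"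
    "ellipse_with E c u v a b"
    "roundness a b = (perp p \<bullet> q)\<^sup>2 / ((p \<bullet> p + q \<bullet> q)\<^sup>2 - 4 * (p \<bullet> q)\<^sup>2)"
proof -
  define T G where "T = p \<bullet> p + q \<bullet> q" and "G = p \<bullet> q"
  have K: "0 < T\<^sup>2 - 4 * G\<^sup>2"
    unfolding T_def G_def by (rule inscribed_denominator_pos[OF ind])
  have T: "0 < T"
    using ind unfolding T_def by (intro add_pos_nonneg) (auto simp: inner_perp)
  define \<rho> where "\<rho> = - 2 * G / T"
  have "\<rho>\<^sup>2 = 4 * G\<^sup>2 / T\<^sup>2"
    by (simp add: \<rho>_def power_divide power_mult_distrib)
  then have \<rho>: "1 - \<rho>\<^sup>2 = (T\<^sup>2 - 4 * G\<^sup>2) / T\<^sup>2"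
    using T by (simp add: diff_divide_distrib)
  then have "0 < 1 - \<rho>\<^sup>2"
    using K T by simp
  then have "\<rho>\<^sup>2 + (sqrt (1 - \<rho>\<^sup>2))\<^sup>2 = 1" and sq: "sqrt (1 - \<rho>\<^sup>2) \<noteq> 0"
    by simp_all
  then obtain \<phi> where \<phi>: "\<rho> = cos \<phi>" "sqrt (1 - \<rho>\<^sup>2) = sin \<phi>"
    using sincos_total_2pi by metis
  have sin: "sin \<phi> \<noteq> 0" and sin2: "(sin \<phi>)\<^sup>2 = (T\<^sup>2 - 4 * G\<^sup>2) / T\<^sup>2"
    using sq \<phi> \<rho> by (auto simp: sin_squared_eq)
  define p' q' where "p' = p + cos \<phi> *\<^sub>R q" and "q' = sin \<phi> *\<^sub>R q"
  define E where "E = range (\<lambda>t. M + cos t *\<^sub>R p' + sin t *\<^sub>R q')"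
  have curve: "cos t *\<^sub>R p' + sin t *\<^sub>R q' = cos t *\<^sub>R p + cos (t - \<phi>) *\<^sub>R q" for t
    by (simp add: p'_def q'_def cos_diff algebra_simps)
  have slope: "- sin t *\<^sub>R p' + cos t *\<^sub>R q' = - sin t *\<^sub>R p - sin (t - \<phi>) *\<^sub>R q" for t
    by (simp add: p'_def q'_def sin_diff algebra_simps)
  have det: "perp p' \<bullet> q' = sin \<phi> * (perp p \<bullet> q)"
    by (simp add: inner_perp p'_def q'_def algebra_simps)
  then have ind': "perp p' \<bullet> q' \<noteq> 0"
    using ind sin by simp
  then obtain u v a b t0 where
    ell: "ellipse_with E M u v a b"
    and "\<And>t. ellipse_path M u v a b t = M + cos (t + t0) *\<^sub>R p' + sin (t + t0) *\<^sub>R q'"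
    and trace: "a\<^sup>2 + b\<^sup>2 = p' \<bullet> p' + q' \<bullet> q'" and ab: "(a * b)\<^sup>2 = (perp p' \<bullet> q')\<^sup>2"
    unfolding E_def using ellipse_conjugate_diameters[where M = M] by blast
  have hull: "E \<subseteq> convex hull {M - p - q, M + p - q, M + p + q, M - p + q}"
    using parallelogram_subset_hull[of "cos t" "cos (t - \<phi>)" M p q for t]
    by (auto simp: E_def add.assoc curve)
  have bnd: "0 \<le> (1 + cos \<phi>) / 2" "(1 + cos \<phi>) / 2 \<le> 1" "0 \<le> (1 - cos \<phi>) / 2" "(1 - cos \<phi>) / 2 \<le> 1"
    using cos_ge_minus_one[of \<phi>] cos_le_one[of \<phi>] by (simp_all del: cos_ge_minus_one cos_le_one)
  note tangentI = tangent_to_segmentI[OF ind', where M = M, folded E_def, unfolded add.assoc curve slope]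
  \<comment> \<open>At the parameters \<open>\<phi> + pi\<close>, \<open>0\<close>,
    \<open>\<phi>\<close> and \<open>pi\<close> one coefficient is 1 or -1 and its derivative
    vanishes, so the velocity is along the side; \<open>r\<close> is read off from the other
    coefficient.\<close>
  have "tangent_to_segment E (M - p - q) (M + p - q)"
    by (rule tangentI[where t = "\<phi> + pi" and r = "(1 - cos \<phi>) / 2" and k = "sin \<phi> / 2"])
      (use bnd sin in \<open>simp_all add: vec_eq_iff field_simps\<close>)
  moreover have "tangent_to_segment E (M + p - q) (M + p + q)"
    by (rule tangentI[where t = 0 and r = "(1 + cos \<phi>) / 2" and k = "sin \<phi> / 2"])
      (use bnd sin in \<open>simp_all add: vec_eq_iff field_simps\<close>)
  moreover have "tangent_to_segment E (M + p + q) (M - p + q)"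
    by (rule tangentI[where t = \<phi> and r = "(1 - cos \<phi>) / 2" and k = "sin \<phi> / 2"])
      (use bnd sin in \<open>simp_all add: vec_eq_iff field_simps\<close>)
  moreover have "tangent_to_segment E (M - p + q) (M - p - q)"
    by (rule tangentI[where t = pi and r = "(1 + cos \<phi>) / 2" and k = "sin \<phi> / 2"])
      (use bnd sin in \<open>simp_all add: vec_eq_iff field_simps\<close>)
  ultimately have "inscribed (M - p - q) (M + p - q) (M + p + q) (M - p + q) E"
    using ellipse_withD[OF ell] hull by (simp add: inscribed_def)
  moreover have "roundness a b = (perp p \<bullet> q)\<^sup>2 / (T\<^sup>2 - 4 * G\<^sup>2)"
  proof -
    have "p' \<bullet> p' + q' \<bullet> q' = p \<bullet> p + ((sin \<phi>)\<^sup>2 + (cos \<phi>)\<^sup>2) * (q \<bullet> q) + 2 * cos \<phi> * (p \<bullet> q)"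
      by (simp add: p'_def q'_def inner_add_left inner_add_right inner_commute[of q p]
          power2_eq_square algebra_simps del: sin_cos_squared_add sin_cos_squared_add3)
    also have "\<dots> = T + 2 * \<rho> * G"
      by (simp add: T_def G_def \<phi>)
    also have "\<dots> = (T\<^sup>2 - 4 * G\<^sup>2) / T"
      using T by (simp add: \<rho>_def field_simps power2_eq_square)
    finally have "a\<^sup>2 + b\<^sup>2 = (T\<^sup>2 - 4 * G\<^sup>2) / T"
      using trace by simp
    moreover have "(a * b)\<^sup>2 = (T\<^sup>2 - 4 * G\<^sup>2) / T\<^sup>2 * (perp p \<bullet> q)\<^sup>2"
      unfolding ab det unfolding power_mult_distrib sin2 ..
    ultimately show ?thesis
      unfolding roundness_def power_divide using T K by (simp add: power2_eq_square)
  qed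
  ultimately show thesis
    using that ell by (simp add: T_def G_def)
qed

section \<open>The criterion for parallelograms\<close>

text \<open>The two maximal roundnesses have the same nonzero numerator, so only their denominators
  have to be compared.\<close>

lemma bielliptic_parallelogram_iff:
  fixes p q M :: "real^2"
  assumes ind: "perp p \<bullet> q \<noteq> 0"
  shows "bielliptic (M - p - q) (M + p - q) (M + p + q) (M - p + q)
    \<longleftrightarrow> (p \<bullet> p - q \<bullet> q)\<^sup>2 = (2 * (p \<bullet> q))\<^sup>2"
    (is "bielliptic ?A ?B ?C ?D \<longleftrightarrow> _")
proof -
  define P Q G where "P = p \<bullet> p" and "Q = q \<bullet> q" and "G = p \<bullet> q"
  obtain EI cI uI vI aI bI where EI: "inscribed ?A ?B ?C ?D EI" "ellipse_with EI cI uI vI aI bI"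
    and rI: "roundness aI bI = (perp p \<bullet> q)\<^sup>2 / ((P + Q)\<^sup>2 - 4 * G\<^sup>2)"
    using inscribed_roundness_attained[OF ind, where M = M] unfolding P_def Q_def G_def by blast
  obtain EO cO uO vO aO bO where EO: "circumscribed ?A ?B ?C ?D EO" "ellipse_with EO cO uO vO aO bO"
    and rO: "roundness aO bO = (perp p \<bullet> q)\<^sup>2 / (4 * P * Q)"
    using circumscribed_roundness_attained[OF ind, where M = M] unfolding P_def Q_def by blast
  have minI: "is_arg_min eccentricity (inscribed ?A ?B ?C ?D) E
      \<longleftrightarrow> inscribed ?A ?B ?C ?D E \<and> eccentricity E = eccentricity EI" for E
    by (rule is_arg_min_eccentricity_iff[where Q = "inscribed ?A ?B ?C ?D", OF _ _ EI rI])
      (use inscribed_roundness_le[OF ind] in \<open>auto simp: P_def Q_def G_def inscribed_def\<close>)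
  have minO: "is_arg_min eccentricity (circumscribed ?A ?B ?C ?D) E
      \<longleftrightarrow> circumscribed ?A ?B ?C ?D E \<and> eccentricity E = eccentricity EO" for E
    by (rule is_arg_min_eccentricity_iff[where Q = "circumscribed ?A ?B ?C ?D", OF _ _ EO rO])
      (use circumscribed_roundness_le[OF ind] in \<open>auto simp: P_def Q_def circumscribed_def\<close>)
  have "bielliptic ?A ?B ?C ?D \<longleftrightarrow> eccentricity EI = eccentricity EO"
    unfolding bielliptic_def minI minO using EI(1) EO(1) by metis
  also have "\<dots> \<longleftrightarrow> roundness aI bI = roundness aO bO"
    using eccentricity_le_iff[OF EI(2) EO(2)] eccentricity_le_iff[OF EO(2) EI(2)] by auto
  also have "\<dots> \<longleftrightarrow> (P + Q)\<^sup>2 - 4 * G\<^sup>2 = 4 * P * Q"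
  proof -
    have "0 < P" "0 < Q"
      using ind by (auto simp: inner_perp P_def Q_def)
    moreover have "0 < (P + Q)\<^sup>2 - 4 * G\<^sup>2"
      unfolding P_def Q_def G_def by (rule inscribed_denominator_pos[OF ind])
    ultimately show ?thesis
      unfolding rI rO using ind by (subst frac_eq_eq) auto
  qed
  also have "\<dots> \<longleftrightarrow> (P - Q)\<^sup>2 = (2 * G)\<^sup>2"
    by (simp add: power2_eq_square algebra_simps)
  finally show ?thesis
    by (simp add: P_def Q_def G_def)
qed

theorem theorem3:
  fixes A B C D :: "real^2"
  assumes "parallelogram A B C D"
  shows "bielliptic A B C D \<longleftrightarrow>
    (\<exists>d\<in>{dist A C, dist B D}. \<exists>s\<in>{dist A B, dist B C, dist C D, dist D A}. d\<^sup>2 = 2 * s\<^sup>2)"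
proof -
  define p q M where "p = (1/2) *\<^sub>R (B - A)" and "q = (1/2) *\<^sub>R (C - B)" and "M = (1/2) *\<^sub>R (A + C)"
  have par: "D = C - (B - A)" and ncol: "\<not> collinear {A, B, C}"
    using assms by (auto simp: parallelogram_def algebra_simps)
  have vertices: "A = M - p - q" "B = M + p - q" "C = M + p + q" "D = M - p + q"
    unfolding par by (simp_all add: p_def q_def M_def vec_eq_iff field_simps)
  \<comment> \<open>A vanishing determinant is equality in Cauchy-Schwarz, which would make
    \<open>A\<close>, \<open>B\<close>, \<open>C\<close> collinear.\<close>
  have ind: "perp p \<bullet> q \<noteq> 0"
  proof
    assume "perp p \<bullet> q = 0"
    then have "(p \<bullet> q)\<^sup>2 = (norm p * norm q)\<^sup>2"
      using inner_perp_power2[of p q] by (simp add: power_mult_distrib power2_norm_eq_inner)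
    then have "\<bar>p \<bullet> q\<bar> = norm p * norm q"
      by (simp add: power2_eq_imp_eq)
    moreover have "A - B = (-2) *\<^sub>R p" "C - B = 2 *\<^sub>R q"
      by (simp_all add: p_def q_def)
    ultimately have "\<bar>(A - B) \<bullet> (C - B)\<bar> = norm (A - B) * norm (C - B)"
      by (simp add: abs_mult)
    then have "collinear {0, A - B, C - B}"
      by (simp only: norm_cauchy_schwarz_equal)
    then show False
      using ncol by (simp add: collinear_3[of A B C])
  qed
  define P Q G where "P = p \<bullet> p" and "Q = q \<bullet> q" and "G = p \<bullet> q"
  have "bielliptic A B C D \<longleftrightarrow> (P - Q)\<^sup>2 = (2 * G)\<^sup>2"
    unfolding vertices P_def Q_def G_def by (rule bielliptic_parallelogram_iff[OF ind])
  also have "\<dots> \<longleftrightarrow> P - Q = 2 * G \<or> P - Q = - (2 * G)"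
    by (rule power2_eq_iff)
  also have "\<dots> \<longleftrightarrow>
    (\<exists>d\<in>{dist A C, dist B D}. \<exists>s\<in>{dist A B, dist B C, dist C D, dist D A}. d\<^sup>2 = 2 * s\<^sup>2)"
  proof -
    have diffs: "A - C = - (2 *\<^sub>R (p + q))" "B - D = 2 *\<^sub>R (p - q)" "A - B = - (2 *\<^sub>R p)"
      "B - C = - (2 *\<^sub>R q)" "C - D = 2 *\<^sub>R p" "D - A = 2 *\<^sub>R q"
      by (simp_all add: vertices vec_eq_iff)
    \<comment> \<open>P - Q = 2 G is the relation for \<open>A C\<close> with \<open>A B\<close>,
      and for \<open>B D\<close> with \<open>B C\<close>; P - Q = - 2 G is the one for the two other
      pairings.\<close>
    have "(dist A C)\<^sup>2 = 4 * (P + Q + 2 * G)" "(dist B D)\<^sup>2 = 4 * (P + Q - 2 * G)"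
      "(dist A B)\<^sup>2 = 4 * P" "(dist B C)\<^sup>2 = 4 * Q" "(dist C D)\<^sup>2 = 4 * P" "(dist D A)\<^sup>2 = 4 * Q"
      by (simp_all add: dist_norm diffs power2_norm_eq_inner P_def Q_def G_def
          inner_add_left inner_add_right inner_diff_left inner_diff_right
          inner_commute[of q p])
    then show ?thesis
      by auto
  qed
  finally show ?thesis .
qed

end
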